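(* Let $r$ be a negative integer. Then for $x\in\mathbb{C}\setminus\{r,r+1,\dots,0\}$: (1) $\Gamma_r(x)=\prod_{n=0}^{-r}(x+n)^{(-1)^{n+1}\binom{-r}{n}}$; (2) $S_r(x)=1$.
   Context: For a negative integer $r$, the $r$-ple Hurwitz zeta function is $\zeta_r(w;x)=\sum_{n=0}^\infty\binom{n+r-1}{n}(n+x)^{-w}$, which equals the finite sum $\sum_{n=0}^{-r}(-1)^n\binom{-r}{n}(n+x)^{-w}$ (powers via the principal branch of the logarithm), entire in $w$. The $r$-ple gamma function is $\Gamma_r(x)=\exp\left(\left.\frac{\partial}{\partial w}\zeta_r(w;x)\right|_{w=0}\right)$, and the $r$-ple sine function is $S_r(x)=\Gamma_r(x)^{-1}\Gamma_r(r-x)^{(-1)^r}$. *)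

theory Defs
  imports "HOL-Analysis.Analysis"
begin

text \<open>
  The multiple Hurwitz zeta, gamma and sine functions of negative order. The definitions are
  meant for \<open>r < 0\<close> only: there the series terminates, because the generalised binomial
  coefficient vanishes for \<open>n > - r\<close> (see \<open>hurwitz_zeta_multiple_finite\<close>). For
  \<open>r \<ge> 0\<close> the series would have to be replaced by its analytic continuation in \<open>w\<close>.
\<close>

definition hurwitz_zeta_multiple :: "int \<Rightarrow> complex \<Rightarrow> complex \<Rightarrow> complex" where
  "hurwitz_zeta_multiple r w x =
     (\<Sum>n. (of_int (int n + r - 1) gchoose n) * (of_nat n + x) powr (- w))"

definition Gamma_multiple :: "int \<Rightarrow> complex \<Rightarrow> complex" where
  "Gamma_multiple r x = exp (deriv (\<lambda>w. hurwitz_zeta_multiple r w x) 0)"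

text \<open>
  The exponent \<open>(-1)\<^sup>r\<close> is an integer; it is written via \<open>\<bar>r\<bar>\<close>, which has the same parity.
\<close>

definition sine_multiple :: "int \<Rightarrow> complex \<Rightarrow> complex" where
  "sine_multiple r x =
     inverse (Gamma_multiple r x) * Gamma_multiple r (of_int r - x) powi ((- 1) ^ nat \<bar>r\<bar>)"

lemma hurwitz_zeta_multiple_finite:
  assumes "r < 0"
  shows "hurwitz_zeta_multiple r w x =
    (\<Sum>n=0..nat (- r). (- 1) ^ n * of_nat (nat (- r) choose n) * (of_nat n + x) powr (- w))"
proof -
  have coeff: "(of_int (int n + r - 1) gchoose n :: complex) =
      (- 1) ^ n * of_nat (nat (- r) choose n)" for n
  proof -
    have "(of_nat (nat (- r)) :: complex) = - of_int r"
      using assms by (simp add: of_nat_nat)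
    then show ?thesis
      using gbinomial_negated_upper[of "of_int (int n + r - 1) :: complex" n]
      by (simp add: binomial_gbinomial)
  qed
  show ?thesis
    unfolding hurwitz_zeta_multiple_def coeff
    by (rule suminf_finite) (auto simp: binomial_eq_0)
qed

end

(* Each term of the finite zeta sum has derivative proportional to - Ln (x + n) at w = 0, so
   exponentiating gives (1). Replacing x by r - x and n by - r - n turns x + n into - (x + n);
   the binomial coefficients add up to the even number 2 ^ (- r), so the signs cancel and
   Gamma_r (r - x) = Gamma_r x ^ ((- 1) ^ r), which gives (2). *)
theory Submission
  imports Defs
begin

text \<open>The multipliers of \<open>Ln (x + of_nat n)\<close> are integers, so exponentiation
  leaves integer powers in which the choice of branch is invisible.\<close>

lemma Gamma_multiple_eq_prod:
  fixes r :: int and x :: complex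
  assumes r: "r < 0" and x: "x \<notin> of_int ` {r..0}"
  shows "Gamma_multiple r x =
    (\<Prod>n=0..nat (- r). (x + of_nat n) powi ((- 1) ^ (n + 1) * int (nat (- r) choose n)))"
proof -
  define N where "N = nat (- r)"
  have nz: "x + of_nat n \<noteq> 0" if "n \<le> N" for n
  proof
    assume "x + of_nat n = 0"
    then have "x = of_int (- int n)" by (simp add: eq_neg_iff_add_eq_0)
    moreover have "- int n \<in> {r..0}" using that r by (auto simp: N_def)
    ultimately show False using x by blast
  qed
  have "((\<lambda>w. hurwitz_zeta_multiple r w x) has_field_derivative
      (\<Sum>n=0..N. (- 1) ^ n * of_nat (N choose n) * (- Ln (x + of_nat n)))) (at 0)"
    unfolding hurwitz_zeta_multiple_finite[OF r] N_def[symmetric]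
  proof (rule DERIV_sum)
    fix n assume "n \<in> {0..N}"
    \<comment> \<open>For a nonzero base \<open>powr\<close> unfolds to
      \<open>exp (- w * Ln (of_nat n + x))\<close>, whose exponential factor is 1 at
      \<open>w = 0\<close>; for base zero it would be the default value 0.\<close>
    then have "of_nat n + x \<noteq> 0" using nz[of n] by (simp add: add.commute)
    then show "((\<lambda>w. (- 1) ^ n * of_nat (N choose n) * (of_nat n + x) powr (- w))
        has_field_derivative (- 1) ^ n * of_nat (N choose n) * (- Ln (x + of_nat n))) (at 0)"
      by (auto intro!: derivative_eq_intros simp: powr_def add.commute)
  qed
  then have "Gamma_multiple r x =
      exp (\<Sum>n=0..N. (- 1) ^ n * of_nat (N choose n) * (- Ln (x + of_nat n)))"
    by (simp only: Gamma_multiple_def DERIV_imp_deriv)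
  also have "\<dots> = (\<Prod>n=0..N. exp ((- 1) ^ n * of_nat (N choose n) * (- Ln (x + of_nat n))))"
    by (simp add: exp_sum)
  also have "\<dots> = (\<Prod>n=0..N. (x + of_nat n) powi ((- 1) ^ (n + 1) * int (N choose n)))"
  proof (rule prod.cong[OF refl])
    fix n assume "n \<in> {0..N}"
    then have "(x + of_nat n) powi k = exp (of_int k * Ln (x + of_nat n))" for k
      using nz[of n] exp_power_int[of "Ln (x + of_nat n)" k] by simp
    then show "exp ((- 1) ^ n * of_nat (N choose n) * (- Ln (x + of_nat n))) =
        (x + of_nat n) powi ((- 1) ^ (n + 1) * int (N choose n))"
      by simp
  qed
  finally show ?thesis by (simp add: N_def)
qed

lemma Gamma_multiple_nonzero: "Gamma_multiple r x \<noteq> 0"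
  by (simp add: Gamma_multiple_def)

text \<open>Only the parity of \<open>k\<close> matters for the sign: the factor
  \<open>(- 1) ^ m\<close> at most inverts a power of -1, and -1 is its own inverse.\<close>

lemma minus_powi_signed:
  fixes a :: "'a::field"
  shows "(- a) powi ((- 1) ^ m * int k) = (- 1) ^ k * a powi ((- 1) ^ m * int k)"
  by (cases "even m"; cases "even k") (auto simp: power_int_minus)

lemma prod_power_int: "(\<Prod>n\<in>A. f n) powi k = (\<Prod>n\<in>A. f n powi k)"
  for f :: "'b \<Rightarrow> 'a::field"
  by (induction A rule: infinite_finite_induct) (auto simp: power_int_mult_distrib)

text \<open>Up to sign, reflection reverses the order of the bases; against this order the exponents
  change by the factor \<open>(- 1) ^ N\<close>, which becomes the outer power.\<close>

lemma Gamma_multiple_reflect: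
  fixes r :: int and x :: complex
  assumes r: "r < 0" and x: "x \<notin> of_int ` {r..0}"
  shows "Gamma_multiple r (of_int r - x) = Gamma_multiple r x powi ((- 1) ^ nat (- r))"
proof -
  define N where "N = nat (- r)"
  have rN: "r = - int N" using r by (simp add: N_def)
  \<comment> \<open>The excluded set is invariant under \<open>k\<close> to \<open>r - k\<close>, so
    the product formula also applies at the reflected point.\<close>
  have x': "of_int r - x \<notin> of_int ` {r..0}"
  proof
    assume "of_int r - x \<in> of_int ` {r..0}"
    then obtain k where k: "k \<in> {r..0}" "of_int r - x = of_int k" by blast
    then have "x = of_int (r - k)" by (simp add: algebra_simps)
    moreover have "r - k \<in> {r..0}" using k by auto
    ultimately show False using x by blast
  qed
  have "Gamma_multiple r (of_int r - x) =
      (\<Prod>n=0..N. (of_int r - x + of_nat n) powi ((- 1) ^ (n + 1) * int (N choose n)))"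
    using Gamma_multiple_eq_prod[OF r x'] by (simp add: N_def)
  also have "\<dots> = (\<Prod>n=0..N. (of_int r - x + of_nat (N - n)) powi
      ((- 1) ^ (N - n + 1) * int (N choose (N - n))))"
    by (rule prod.reindex_bij_witness[where i = "\<lambda>n. N - n" and j = "\<lambda>n. N - n"]) auto
  also have "\<dots> = (\<Prod>n=0..N. (- 1) ^ (N choose n) *
      ((x + of_nat n) powi ((- 1) ^ (n + 1) * int (N choose n))) powi ((- 1) ^ N))"
  proof (rule prod.cong[OF refl])
    fix n assume "n \<in> {0..N}"
    then have n: "n \<le> N" by simp
    \<comment> \<open>As \<open>n \<le> N\<close>, the subtraction is not truncated, and
      \<open>N - n\<close> has the parity of \<open>N + n\<close>.\<close>
    have "(- 1 :: int) ^ (N - n + 1) = (- 1) ^ (n + 1) * (- 1) ^ N"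
      using n by (cases "even n"; cases "even N") auto
    moreover have "of_int r - x + of_nat (N - n) = - (x + of_nat n)"
      using n by (simp add: rN of_nat_diff)
    moreover have "N choose (N - n) = N choose n"
      using n binomial_symmetric by metis
    ultimately have "(of_int r - x + of_nat (N - n)) powi
          ((- 1) ^ (N - n + 1) * int (N choose (N - n))) =
        (- (x + of_nat n)) powi ((- 1) ^ (n + 1 + N) * int (N choose n))"
      by (simp only: power_add)
    also have "\<dots> = (- 1) ^ (N choose n) *
        (x + of_nat n) powi ((- 1) ^ (n + 1 + N) * int (N choose n))"
      by (rule minus_powi_signed)
    \<comment> \<open>The sign \<open>(- 1) ^ N\<close> does not depend on \<open>n\<close>; as an
      outer power it can be pulled out of the whole product.\<close>
    also have "(x + of_nat n) powi ((- 1) ^ (n + 1 + N) * int (N choose n)) =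
        ((x + of_nat n) powi ((- 1) ^ (n + 1) * int (N choose n))) powi ((- 1) ^ N)"
      by (simp only: power_int_mult[symmetric] power_add mult_ac)
    finally show "(of_int r - x + of_nat (N - n)) powi
          ((- 1) ^ (N - n + 1) * int (N choose (N - n))) =
        (- 1) ^ (N choose n) *
          ((x + of_nat n) powi ((- 1) ^ (n + 1) * int (N choose n))) powi ((- 1) ^ N)" .
  qed
  also have "\<dots> = (- 1) ^ (\<Sum>n=0..N. N choose n) * Gamma_multiple r x powi ((- 1) ^ N)"
    by (simp add: Gamma_multiple_eq_prod[OF r x] prod.distrib power_sum prod_power_int N_def)
  also have "(\<Sum>n=0..N. N choose n) = 2 ^ N"
    by (simp add: atLeast0AtMost choose_row_sum)
  \<comment> \<open>Here \<open>r < 0\<close> gives \<open>N > 0\<close>, so \<open>2 ^ N\<close> is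
    even; for \<open>N = 0\<close> the sign would be -1.\<close>
  also have "(- 1 :: complex) ^ (2 ^ N) = 1"
    using r by (simp add: N_def)
  finally show ?thesis by (simp add: N_def)
qed

theorem theorem1:
  fixes r :: int and x :: complex
  assumes "r < 0"
    and "x \<notin> of_int ` {r..0}"
  shows "Gamma_multiple r x =
           (\<Prod>n=0..nat (- r). (x + of_nat n) powi ((- 1) ^ (n + 1) * int (nat (- r) choose n)))
         \<and> sine_multiple r x = 1"
proof
  show "Gamma_multiple r x =
      (\<Prod>n=0..nat (- r). (x + of_nat n) powi ((- 1) ^ (n + 1) * int (nat (- r) choose n)))"
    using assms by (rule Gamma_multiple_eq_prod)
  \<comment> \<open>The outer power from the reflection and the one in the definition of
    \<open>sine_multiple\<close> thus cancel, leaving \<open>Gamma_multiple r x\<close> divided by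
    itself.\<close>
  have "((- 1) ^ nat (- r) * (- 1) ^ nat (- r) :: int) = 1"
    by (simp flip: power_mult_distrib)
  then have "Gamma_multiple r (of_int r - x) powi ((- 1) ^ nat \<bar>r\<bar>) = Gamma_multiple r x"
    using assms(1) by (simp add: Gamma_multiple_reflect[OF assms] flip: power_int_mult)
  then show "sine_multiple r x = 1"
    by (simp add: sine_multiple_def Gamma_multiple_nonzero)
qed

end
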